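(* Let $s\ge 2$ be an integer and $c>2$ a constant. Then \[ \mathbf{RT}_s\big(n,K_{2s},c\,\mathbf{f}_{s,s+1}(n/2)\big)\ge \mathbf{z}(n/2,s). \]
   Context: For a graph $G$ and integer $s\ge 2$, the $s$-independence number $\alpha_s(G)$ is the maximum number of vertices of an induced subgraph of $G$ containing no copy of $K_s$. For a graph $H$ and a function $f=f(n)$, $\mathbf{RT}_s(n,H,f)$ is the maximum number of edges of an $H$-free graph on $n$ vertices with $\alpha_s(G)<f$ (or $0$ if no such graph exists). The Erdős–Rogers number $\mathbf{f}_{s,t}(m)$ is the minimum of $\alpha_s(G)$ over all $K_t$-free graphs $G$ on $m$ vertices. The Zarankiewicz function $\mathbf{z}(m,s)$ is the maximum number of edges in a $K_{s,s}$-free bipartite graph with both parts of size $m$. Rounding of $n/2$ is ignored. *)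

theory Defs
  imports Complex_Main "HOL-Library.Ramsey"
begin

text \<open>
  A graph is a pair of a vertex set and an edge set; \<open>[V]\<^bsup>2\<^esup>\<close> (from the Ramsey library theory) is
  the set of two-element subsets of \<open>V\<close>.
\<close>

type_synonym 'a graph = "'a set \<times> 'a set set"

abbreviation verts :: "'a graph \<Rightarrow> 'a set" where "verts \<equiv> fst"
abbreviation edges :: "'a graph \<Rightarrow> 'a set set" where "edges \<equiv> snd"

definition simple_graph :: "'a graph \<Rightarrow> bool" where
  "simple_graph G \<longleftrightarrow> finite (verts G) \<and> edges G \<subseteq> [verts G]\<^bsup>2\<^esup>"

definition induced :: "'a graph \<Rightarrow> 'a set \<Rightarrow> 'a graph" where
  "induced G W = (W, {e \<in> edges G. e \<subseteq> W})"

text \<open>A copy of \<open>H\<close> in \<open>G\<close> is a subgraph of \<open>G\<close>, not necessarily induced, isomorphic to \<open>H\<close>.\<close>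

definition contains_copy :: "'a graph \<Rightarrow> 'b graph \<Rightarrow> bool" where
  "contains_copy G H \<longleftrightarrow>
     (\<exists>\<phi>. inj_on \<phi> (verts H) \<and> \<phi> ` verts H \<subseteq> verts G \<and> (\<forall>e\<in>edges H. \<phi> ` e \<in> edges G))"

abbreviation free_of :: "'a graph \<Rightarrow> 'b graph \<Rightarrow> bool" where
  "free_of G H \<equiv> \<not> contains_copy G H"

definition complete_graph :: "nat \<Rightarrow> nat graph" where
  "complete_graph r = ({..<r}, [{..<r}]\<^bsup>2\<^esup>)"

definition complete_bipartite :: "nat \<Rightarrow> nat \<Rightarrow> nat graph" where
  "complete_bipartite r s = ({..<r + s}, {{i, r + j} | i j. i < r \<and> j < s})"

definition bipartition :: "'a graph \<Rightarrow> 'a set \<Rightarrow> 'a set \<Rightarrow> bool" where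
  "bipartition G A B \<longleftrightarrow>
     A \<union> B = verts G \<and> A \<inter> B = {} \<and> (\<forall>e\<in>edges G. \<exists>a\<in>A. \<exists>b\<in>B. e = {a, b})"

definition alpha :: "nat \<Rightarrow> 'a graph \<Rightarrow> nat" where
  "alpha s G = Max {card W | W. W \<subseteq> verts G \<and> free_of (induced G W) (complete_graph s)}"

text \<open>
  The extremal functions range over graphs with vertex set \<open>{..<n}\<close>, which represent all graphs
  on \<open>n\<close> vertices up to isomorphism.
\<close>

definition graphs_on :: "nat \<Rightarrow> nat graph set" where
  "graphs_on n = {G. simple_graph G \<and> verts G = {..<n}}"

definition RT :: "nat \<Rightarrow> nat \<Rightarrow> 'b graph \<Rightarrow> real \<Rightarrow> nat" where
  "RT s n H f =
     (let \<G> = {G \<in> graphs_on n. free_of G H \<and> real (alpha s G) < f}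
      in if \<G> = {} then 0 else Max ((\<lambda>G. card (edges G)) ` \<G>))"

definition erdos_rogers :: "nat \<Rightarrow> nat \<Rightarrow> nat \<Rightarrow> nat" where
  "erdos_rogers s t m = Min (alpha s ` {G \<in> graphs_on m. free_of G (complete_graph t)})"

definition zarankiewicz :: "nat \<Rightarrow> nat \<Rightarrow> nat" where
  "zarankiewicz m s =
     Max ((\<lambda>G. card (edges G)) `
       {G \<in> graphs_on (2 * m). (\<exists>A B. bipartition G A B \<and> card A = m \<and> card B = m) \<and>
          free_of G (complete_bipartite s s)})"

text \<open>
  Rounding of \<open>n/2\<close> in the inequality between these functions: the Erdos-Rogers argument is rounded
  up and the Zarankiewicz argument down, so that for even \<open>n\<close> both are exactly \<open>n/2\<close>. Rounding both
  the same way is false for some small odd \<open>n\<close> (down: \<open>s = 5\<close>, \<open>n = 3\<close>, \<open>c \<le> 3\<close>; up: \<open>n = 1\<close>).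
\<close>

end

theory Submission
  imports Defs
begin

text \<open>
  Let \<open>Z\<close> be an extremal \<open>K\<^sub>s\<^sub>,\<^sub>s\<close>-free bipartite graph and \<open>G\<close> an optimal \<open>K\<^sub>s\<^sub>+\<^sub>1\<close>-free graph for the
  Erdos-Rogers number, and put a copy of \<open>G\<close> inside each part of \<open>Z\<close>. A clique of size \<open>2s\<close> has at
  most \<open>s\<close> vertices in each part, so it would meet both parts in exactly \<open>s\<close> vertices and give a
  \<open>K\<^sub>s\<^sub>,\<^sub>s\<close> in \<open>Z\<close>. A \<open>K\<^sub>s\<close>-free set meets each part in at most \<open>\<alpha>\<^sub>s(G)\<close> vertices, so its size is at
  most \<open>2 \<alpha>\<^sub>s(G) < c \<alpha>\<^sub>s(G)\<close>. For odd \<open>n\<close> the spare vertex joins one part, isolated in \<open>Z\<close>, and the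
  other part carries a copy of an induced subgraph of \<open>G\<close>.
\<close>

section \<open>Complete and complete bipartite subgraphs as vertex sets\<close>

lemma contains_complete_graph_iff:
  "contains_copy G (complete_graph r) \<longleftrightarrow>
     (\<exists>K. K \<subseteq> verts G \<and> finite K \<and> card K = r \<and> [K]\<^bsup>2\<^esup> \<subseteq> edges G)"
proof
  assume "contains_copy G (complete_graph r)"
  then obtain \<phi> where \<phi>: "inj_on \<phi> {..<r}" "\<phi> ` {..<r} \<subseteq> verts G"
      "\<And>e. e \<in> [{..<r}]\<^bsup>2\<^esup> \<Longrightarrow> \<phi> ` e \<in> edges G"
    by (auto simp: contains_copy_def complete_graph_def)
  have "[\<phi> ` {..<r}]\<^bsup>2\<^esup> \<subseteq> edges G"
    using \<phi>(1,3) by (metis nset_image_obtains subsetI)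
  then show "\<exists>K. K \<subseteq> verts G \<and> finite K \<and> card K = r \<and> [K]\<^bsup>2\<^esup> \<subseteq> edges G"
    using \<phi> by (intro exI[of _ "\<phi> ` {..<r}"]) (simp add: card_image)
next
  assume "\<exists>K. K \<subseteq> verts G \<and> finite K \<and> card K = r \<and> [K]\<^bsup>2\<^esup> \<subseteq> edges G"
  then obtain K where K: "K \<subseteq> verts G" "finite K" "card K = r" "[K]\<^bsup>2\<^esup> \<subseteq> edges G"
    by blast
  then obtain \<phi> where \<phi>: "bij_betw \<phi> {..<r} K"
    using ex_bij_betw_nat_finite[of K] by (auto simp: atLeast0LessThan)
  then have "\<phi> ` e \<in> [K]\<^bsup>2\<^esup>" if "e \<in> [{..<r}]\<^bsup>2\<^esup>" for e
    using bij_betw_nsets[OF \<phi>, of 2] that by (auto simp: bij_betw_def)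
  then show "contains_copy G (complete_graph r)"
    using \<phi> K unfolding contains_copy_def complete_graph_def
    by (intro exI[of _ \<phi>]) (auto simp: bij_betw_def)
qed

lemma nsets_induced_iff:
  assumes "K \<subseteq> W"
  shows "[K]\<^bsup>2\<^esup> \<subseteq> edges (induced G W) \<longleftrightarrow> [K]\<^bsup>2\<^esup> \<subseteq> edges G"
  using assms by (auto simp: induced_def nsets_def)

lemma induced_contains_complete_graph_iff:
  "contains_copy (induced G W) (complete_graph r) \<longleftrightarrow>
     (\<exists>K. K \<subseteq> W \<and> finite K \<and> card K = r \<and> [K]\<^bsup>2\<^esup> \<subseteq> edges G)"
  using nsets_induced_iff[of _ W G]
  by (auto simp: contains_complete_graph_iff) (auto simp: induced_def)

text \<open>A larger clique would contain one on exactly \<open>r\<close> vertices. This turns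
  freeness into a size bound, the form needed for cliques inside one part.\<close>

lemma complete_graph_free_card_less:
  assumes "free_of G (complete_graph r)" "K \<subseteq> verts G" "finite K" "[K]\<^bsup>2\<^esup> \<subseteq> edges G"
  shows "card K < r"
proof (rule ccontr)
  assume "\<not> card K < r"
  then obtain L where L: "L \<subseteq> K" "card L = r"
    by (meson not_le obtain_subset_with_card_n)
  then have "[L]\<^bsup>2\<^esup> \<subseteq> edges G" "finite L"
    using assms(3,4) nsets_mono[of L K 2] finite_subset by auto
  then show False
    using L assms(1,2) unfolding contains_complete_graph_iff by blast
qed

text \<open>Enumerations of \<open>X\<close> and \<open>Y\<close> are glued into one map, the second
  shifted by \<open>r\<close> as in \<open>complete_bipartite\<close>. Disjointness of
  \<open>X\<close> and \<open>Y\<close> makes the glued map injective.\<close>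

lemma contains_complete_bipartiteI:
  assumes "finite X" "card X = r" "finite Y" "card Y = s" "X \<inter> Y = {}" "X \<union> Y \<subseteq> verts G"
    and E: "\<And>x y. x \<in> X \<Longrightarrow> y \<in> Y \<Longrightarrow> {x, y} \<in> edges G"
  shows "contains_copy G (complete_bipartite r s)"
proof -
  obtain f g where f: "bij_betw f {..<r} X" and g: "bij_betw g {..<s} Y"
    using ex_bij_betw_nat_finite[of X] ex_bij_betw_nat_finite[of Y] assms(1-4)
    by (auto simp: atLeast0LessThan)
  define h where "h i = (if i < r then f i else g (i - r))" for i
  have hX: "h i \<in> X" if "i < r" for i
    using f that by (auto simp: h_def bij_betw_def)
  have hY: "h (r + j) \<in> Y" if "j < s" for j
    using g that by (auto simp: h_def bij_betw_def)
  have hY': "h i \<in> Y" if "i < r + s" "\<not> i < r" for i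
    using hY[of "i - r"] that by auto
  have "inj_on h {..<r + s}"
  proof (rule inj_onI)
    fix i j assume ij: "i \<in> {..<r + s}" "j \<in> {..<r + s}" "h i = h j"
    consider "i < r" "j < r" | "\<not> i < r" "\<not> j < r" | "i < r \<longleftrightarrow> \<not> j < r" by blast
    then show "i = j"
    proof cases
      case 1
      then show ?thesis
        using f ij by (auto simp: h_def bij_betw_def inj_on_def)
    next
      case 2
      then have "i - r = j - r"
        using g ij by (auto simp: h_def bij_betw_def inj_on_def)
      with 2 show ?thesis by simp
    next
      case 3
      then show ?thesis
        using hX[of i] hX[of j] hY'[of i] hY'[of j] ij assms(5) by auto
    qed
  qed
  moreover have "h ` {..<r + s} \<subseteq> verts G"
    using hX hY' assms(6) by blast
  ultimately show ?thesis
    using E hX hY unfolding contains_copy_def complete_bipartite_def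
    by (intro exI[of _ h]) auto
qed

section \<open>The s-independence number\<close>

lemma finite_alpha_candidates:
  "finite (verts G) \<Longrightarrow> finite {card W | W. W \<subseteq> verts G \<and> free_of (induced G W) (complete_graph s)}"
  by simp

lemma card_le_alpha:
  assumes "finite (verts G)" "W \<subseteq> verts G" "free_of (induced G W) (complete_graph s)"
  shows "card W \<le> alpha s G"
  unfolding alpha_def using assms by (intro Max_ge finite_alpha_candidates) auto

text \<open>For \<open>s > 0\<close> the empty set is a candidate, so the maximum is taken over a
  nonempty finite set. For \<open>s = 0\<close> there is no candidate, since the complete graph on
  no vertices embeds everywhere.\<close>

lemma alpha_attained:
  assumes "finite (verts G)" "s > 0"
  obtains W where "W \<subseteq> verts G" "free_of (induced G W) (complete_graph s)" "alpha s G = card W"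
proof -
  have "free_of (induced G {}) (complete_graph s)"
    using assms(2) by (auto simp: induced_contains_complete_graph_iff)
  then have "alpha s G \<in> {card W | W. W \<subseteq> verts G \<and> free_of (induced G W) (complete_graph s)}"
    unfolding alpha_def using assms(1) by (intro Max_in finite_alpha_candidates) auto
  then show thesis using that by blast
qed

text \<open>A single vertex is a candidate once \<open>s \<ge> 2\<close>. Positivity is what later
  makes the comparison between factors 2 and \<open>c\<close> strict.\<close>

lemma alpha_pos:
  assumes "finite (verts G)" "verts G \<noteq> {}" "s \<ge> 2"
  shows "alpha s G > 0"
proof -
  obtain v where v: "v \<in> verts G" using assms(2) by blast
  have "card K \<noteq> s" if "K \<subseteq> {v}" for K
    using card_mono[OF _ that] assms(3) by simp
  then have "free_of (induced G {v}) (complete_graph s)"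
    unfolding induced_contains_complete_graph_iff by blast
  then show ?thesis
    using card_le_alpha[of G "{v}" s] assms(1) v by simp
qed

section \<open>Transport of cliques along injections\<close>

text \<open>Only pairs inside \<open>P\<close> are compared, so \<open>H\<close> may have any other
  edges. It thus applies to one part of the blow-up in spite of the crossing edges.\<close>

lemma clique_image_iff:
  assumes "inj_on p P" "\<And>e. e \<in> [P]\<^bsup>2\<^esup> \<Longrightarrow> e \<in> edges H \<longleftrightarrow> p ` e \<in> edges G" "K \<subseteq> P"
  shows "[p ` K]\<^bsup>2\<^esup> \<subseteq> edges G \<longleftrightarrow> [K]\<^bsup>2\<^esup> \<subseteq> edges H"
proof -
  have inj: "inj_on p K" using assms(1,3) inj_on_subset by blast
  have "[p ` K]\<^bsup>2\<^esup> = (`) p ` [K]\<^bsup>2\<^esup>"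
    using bij_betw_nsets[of p K "p ` K" 2] inj by (auto simp: bij_betw_def)
  moreover have "e \<in> edges H \<longleftrightarrow> p ` e \<in> edges G" if "e \<in> [K]\<^bsup>2\<^esup>" for e
    using assms(2) nsets_mono[OF assms(3)] that by (meson subsetD)
  ultimately show ?thesis
    by (simp add: subset_eq)
qed

lemma induced_image_free:
  assumes "inj_on p P" "\<And>e. e \<in> [P]\<^bsup>2\<^esup> \<Longrightarrow> e \<in> edges H \<longleftrightarrow> p ` e \<in> edges G"
    and "W \<subseteq> P" "free_of (induced H W) (complete_graph r)"
  shows "free_of (induced G (p ` W)) (complete_graph r)"
proof
  assume "contains_copy (induced G (p ` W)) (complete_graph r)"
  then obtain L where "L \<subseteq> p ` W" "finite L" "card L = r" "[L]\<^bsup>2\<^esup> \<subseteq> edges G"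
    unfolding induced_contains_complete_graph_iff by blast
  moreover from this obtain K where K: "K \<subseteq> W" "L = p ` K"
    by (meson subset_imageE)
  moreover have "inj_on p K" using assms(1,3) K(1) by (meson inj_on_subset)
  ultimately have "finite K" "card K = r" "[K]\<^bsup>2\<^esup> \<subseteq> edges H"
    using clique_image_iff[where p=p and P=P and H=H and G=G and K=K] assms(1-3)
    by (auto simp: card_image finite_image_iff)
  then show False
    using assms(4) K(1) unfolding induced_contains_complete_graph_iff by blast
qed

section \<open>Attainment of the extremal values\<close>

lemma finite_graphs_on: "finite (graphs_on n)"
proof (rule finite_subset)
  show "graphs_on n \<subseteq> {{..<n}} \<times> Pow (Pow {..<n})"
    by (fastforce simp: graphs_on_def simple_graph_def nsets_def)
qed simp

lemma edgeless_in_graphs_on: "({..<n}, {}) \<in> graphs_on n"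
  by (simp add: graphs_on_def simple_graph_def)

text \<open>The edgeless graph is a candidate because \<open>t \<ge> 2\<close>, so the minimum is
  not over an empty set.\<close>

lemma erdos_rogers_attained:
  assumes "t \<ge> 2"
  obtains G where "G \<in> graphs_on m" "free_of G (complete_graph t)" "erdos_rogers s t m = alpha s G"
proof -
  have "\<not> [K]\<^bsup>2\<^esup> \<subseteq> {}" if "finite K" "card K = t" for K :: "nat set"
    using assms that by (simp add: nsets_eq_empty_iff)
  then have "free_of ({..<m}, {}) (complete_graph t)"
    by (auto simp: contains_complete_graph_iff)
  then have "erdos_rogers s t m \<in> alpha s ` {G \<in> graphs_on m. free_of G (complete_graph t)}"
    unfolding erdos_rogers_def using finite_graphs_on edgeless_in_graphs_on
    by (intro Min_in) auto
  then show thesis using that by blast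
qed

text \<open>The edgeless graph split into two halves is a candidate, since for \<open>s > 0\<close>
  the forbidden graph has an edge.\<close>

lemma zarankiewicz_attained:
  assumes "s > 0"
  obtains Z A B where "Z \<in> graphs_on (2 * m)" "bipartition Z A B" "card A = m" "card B = m"
    "free_of Z (complete_bipartite s s)" "zarankiewicz m s = card (edges Z)"
proof -
  let ?S = "{G \<in> graphs_on (2 * m). (\<exists>A B. bipartition G A B \<and> card A = m \<and> card B = m) \<and>
          free_of G (complete_bipartite s s)}"
  have "bipartition ({..<2 * m}, {}) {..<m} {m..<2 * m}"
    by (auto simp: bipartition_def)
  moreover have "free_of ({..<2 * m}, {}) (complete_bipartite s s)"
    using assms by (auto simp: contains_copy_def complete_bipartite_def)
  ultimately have "({..<2 * m}, {}) \<in> ?S"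
    using edgeless_in_graphs_on by fastforce
  then have "zarankiewicz m s \<in> (\<lambda>G. card (edges G)) ` ?S"
    unfolding zarankiewicz_def using finite_graphs_on by (intro Max_in) auto
  then show thesis using that by blast
qed

text \<open>The graph itself shows that the family is nonempty, which excludes the default value 0
  of \<open>RT\<close>.\<close>

lemma card_edges_le_RT:
  assumes "G \<in> graphs_on n" "free_of G H" "real (alpha s G) < f"
  shows "card (edges G) \<le> RT s n H f"
proof -
  let ?S = "{G \<in> graphs_on n. free_of G H \<and> real (alpha s G) < f}"
  have "G \<in> ?S" "finite ?S" using assms finite_graphs_on by auto
  moreover from this(1) have "?S \<noteq> {}" by blast
  ultimately show ?thesis
    unfolding RT_def Let_def by (simp only: if_False) (intro Max_ge finite_imageI imageI)
qed

section \<open>The blow-up construction\<close>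

text \<open>The parts need only be at most as large as \<open>G\<close>: each is injected into
  \<open>G\<close> and inherits an induced subgraph. This accommodates the unequal parts that arise
  for odd \<open>n\<close>.\<close>

lemma bipartite_blowup:
  assumes G: "G \<in> graphs_on m" "free_of G (complete_graph (s + 1))"
    and Z: "simple_graph Z" "bipartition Z A B" "free_of Z (complete_bipartite s s)"
    and card: "card A \<le> m" "card B \<le> m" and s: "s > 0"
  obtains H where "simple_graph H" "verts H = verts Z" "edges Z \<subseteq> edges H"
    "free_of H (complete_graph (2 * s))" "alpha s H \<le> 2 * alpha s G"
proof -
  have AB: "verts Z = A \<union> B" "A \<inter> B = {}"
    and EZ: "\<And>e. e \<in> edges Z \<Longrightarrow> \<exists>a\<in>A. \<exists>b\<in>B. e = {a, b}"
    using Z(2) by (auto simp: bipartition_def)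
  have fin: "finite A" "finite B"
    using Z(1) AB(1) unfolding simple_graph_def by (metis finite_Un)+
  have vG: "verts G = {..<m}" using G(1) by (simp add: graphs_on_def)
  obtain p q where p: "inj_on p A" "p ` A \<subseteq> verts G" and q: "inj_on q B" "q ` B \<subseteq> verts G"
    using card_le_inj[of A "{..<m}"] card_le_inj[of B "{..<m}"] fin card vG by auto
  define H where "H = (verts Z, edges Z \<union> {e \<in> [A]\<^bsup>2\<^esup>. p ` e \<in> edges G} \<union> {e \<in> [B]\<^bsup>2\<^esup>. q ` e \<in> edges G})"
  \<comment> \<open>The three edge sets united in \<open>H\<close> cannot overlap, so adjacency in
    \<open>H\<close> within a part is decided by \<open>G\<close> alone.\<close>
  have disj: "e \<notin> [B]\<^bsup>2\<^esup>" if "e \<in> [A]\<^bsup>2\<^esup>" for e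
  proof
    assume "e \<in> [B]\<^bsup>2\<^esup>"
    with that AB(2) have "e = {}" by (auto simp: nsets_def)
    with that show False by (simp add: nsets_def)
  qed
  have Z_cross: "e \<notin> [A]\<^bsup>2\<^esup>" "e \<notin> [B]\<^bsup>2\<^esup>" if "e \<in> edges Z" for e
    using EZ[OF that] AB(2) by (auto simp: nsets_def)
  have EA: "e \<in> edges H \<longleftrightarrow> p ` e \<in> edges G" if "e \<in> [A]\<^bsup>2\<^esup>" for e
    using that disj Z_cross by (auto simp: H_def)
  have EB: "e \<in> edges H \<longleftrightarrow> q ` e \<in> edges G" if "e \<in> [B]\<^bsup>2\<^esup>" for e
    using that disj Z_cross by (auto simp: H_def)
  have vH: "verts H = A \<union> B" and finH: "finite (verts H)"
    using AB fin by (auto simp: H_def)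
  \<comment> \<open>Both this bound and the next are stated for a generic injection \<open>g\<close>
    on \<open>P\<close>, to serve \<open>p\<close> on \<open>A\<close> and \<open>q\<close> on
    \<open>B\<close> alike.\<close>
  have part_clique: "card K \<le> s"
    if "inj_on g P" "g ` P \<subseteq> verts G" "\<And>e. e \<in> [P]\<^bsup>2\<^esup> \<Longrightarrow> e \<in> edges H \<longleftrightarrow> g ` e \<in> edges G"
      "K \<subseteq> P" "finite K" "[K]\<^bsup>2\<^esup> \<subseteq> edges H" for g P K
  proof -
    have "[g ` K]\<^bsup>2\<^esup> \<subseteq> edges G"
      using clique_image_iff[where p=g and P=P and H=H and G=G and K=K] that by blast
    then have "card (g ` K) < s + 1"
      using G(2) that by (intro complete_graph_free_card_less) blast+
    then show ?thesis
      using that(1,4) by (metis card_image inj_on_subset less_Suc_eq_le Suc_eq_plus1)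
  qed
  have part_alpha: "card W \<le> alpha s G"
    if "inj_on g P" "g ` P \<subseteq> verts G" "\<And>e. e \<in> [P]\<^bsup>2\<^esup> \<Longrightarrow> e \<in> edges H \<longleftrightarrow> g ` e \<in> edges G"
      "W \<subseteq> P" "free_of (induced H W) (complete_graph s)" for g P W
  proof -
    have "free_of (induced G (g ` W)) (complete_graph s)"
      using induced_image_free[where p=g and P=P and H=H and G=G and W=W] that by blast
    then have "card (g ` W) \<le> alpha s G"
      using that vG by (intro card_le_alpha) auto
    then show ?thesis
      using that(1,4) by (metis card_image inj_on_subset)
  qed
  have "simple_graph H"
    using Z(1) AB(1) nsets_mono[of A "A \<union> B" 2] nsets_mono[of B "A \<union> B" 2]
    by (auto simp: simple_graph_def H_def)
  moreover have "free_of H (complete_graph (2 * s))"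
  proof
    assume "contains_copy H (complete_graph (2 * s))"
    then obtain K where K: "K \<subseteq> A \<union> B" "finite K" "card K = 2 * s" "[K]\<^bsup>2\<^esup> \<subseteq> edges H"
      unfolding contains_complete_graph_iff vH by blast
    let ?X = "K \<inter> A" and ?Y = "K \<inter> B"
    have "[?X]\<^bsup>2\<^esup> \<subseteq> edges H" "[?Y]\<^bsup>2\<^esup> \<subseteq> edges H"
      using K(4) nsets_mono[of ?X K 2] nsets_mono[of ?Y K 2] by auto
    then have le: "card ?X \<le> s" "card ?Y \<le> s"
      using part_clique[OF p EA] part_clique[OF q EB] K(2) by auto
    have "card K = card ?X + card ?Y"
      using K(1,2) AB(2) by (subst card_Un_disjoint[symmetric]) (auto intro: arg_cong[where f=card])
    with le K(3) have eq: "card ?X = s" "card ?Y = s" by auto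
    have "{x, y} \<in> edges Z" if "x \<in> ?X" "y \<in> ?Y" for x y
    proof -
      have "x \<noteq> y" using that AB(2) by auto
      then have "{x, y} \<in> edges H" using K(4) that by (auto simp: nsets_def)
      \<comment> \<open>The pair crosses between the parts, so it can only be an edge of
        \<open>H\<close> by being one of \<open>Z\<close>.\<close>
      then show ?thesis using that AB(2) by (auto simp: H_def nsets_def)
    qed
    then have "contains_copy Z (complete_bipartite s s)"
      using eq K(2) AB by (intro contains_complete_bipartiteI[of ?X _ ?Y]) auto
    with Z(3) show False by blast
  qed
  moreover have "alpha s H \<le> 2 * alpha s G"
  proof -
    obtain W where W: "W \<subseteq> A \<union> B" "free_of (induced H W) (complete_graph s)" "alpha s H = card W"
      using alpha_attained[OF finH s] vH by auto
    \<comment> \<open>A clique in \<open>W \<inter> P\<close> is also one in \<open>W\<close>, so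
      freeness passes to both pieces of \<open>W\<close>.\<close>
    have "free_of (induced H (W \<inter> P)) (complete_graph s)" for P
      using W(2) unfolding induced_contains_complete_graph_iff by blast
    then have "card (W \<inter> A) \<le> alpha s G" "card (W \<inter> B) \<le> alpha s G"
      using part_alpha[OF p EA] part_alpha[OF q EB] by auto
    moreover have "card W \<le> card (W \<inter> A) + card (W \<inter> B)"
      using W(1) card_Un_le[of "W \<inter> A" "W \<inter> B"] by (simp add: Int_Un_distrib[symmetric] Int_absorb2)
    ultimately show ?thesis using W(3) by simp
  qed
  ultimately show thesis
    using that[of H] by (auto simp: H_def)
qed

theorem theorem7p4:
  fixes s n :: nat and c :: real
  assumes "s \<ge> 2" and "c > 2"
  shows "RT s n (complete_graph (2 * s)) (c * real (erdos_rogers s (s + 1) (nat \<lceil>real n / 2\<rceil>)))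
           \<ge> zarankiewicz (nat \<lfloor>real n / 2\<rfloor>) s"
proof -
  define k where "k = nat \<lfloor>real n / 2\<rfloor>"
  define m where "m = nat \<lceil>real n / 2\<rceil>"
  have k: "k = n div 2" unfolding k_def
    using floor_divide_of_nat_eq[of n 2, where ?'a = real] by simp
  have m: "m = n - n div 2"
  proof -
    have "\<lceil>real n / 2\<rceil> = int (n - n div 2)"
      by (rule ceiling_unique) (cases "even n"; auto elim!: evenE oddE simp: field_simps)+
    then show ?thesis by (simp add: m_def)
  qed
  have "s > 0" "s + 1 \<ge> 2" using assms(1) by auto
  obtain Z A B where Z: "Z \<in> graphs_on (2 * k)" "bipartition Z A B" "card A = k" "card B = k"
    "free_of Z (complete_bipartite s s)" "zarankiewicz k s = card (edges Z)"
    by (rule zarankiewicz_attained[OF \<open>s > 0\<close>])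
  obtain G where G: "G \<in> graphs_on m" "free_of G (complete_graph (s + 1))"
    "erdos_rogers s (s + 1) m = alpha s G"
    by (rule erdos_rogers_attained[OF \<open>s + 1 \<ge> 2\<close>])
  show ?thesis
  proof (cases "n = 0")
    case True
    then have "edges Z = {}"
      using Z(1) k by (auto simp: graphs_on_def simple_graph_def nsets_def)
    then show ?thesis using Z(6) by (simp add: k_def)
  next
    case False
    \<comment> \<open>The interval is empty for even \<open>n\<close> and holds the one spare vertex
      for odd \<open>n\<close>, so \<open>?A\<close> has at most \<open>m\<close> vertices.\<close>
    let ?A = "A \<union> {2 * k..<n}" and ?Z = "({..<n}, edges Z)"
    have AB: "A \<union> B = {..<2 * k}" "A \<inter> B = {}" "edges Z \<subseteq> [{..<2 * k}]\<^bsup>2\<^esup>"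
      using Z(1,2) by (auto simp: bipartition_def graphs_on_def simple_graph_def)
    have kn: "2 * k \<le> n" "n - 2 * k + k = m" "k \<le> m" using k m by auto
    have sZ: "simple_graph ?Z"
      using AB(3) kn(1) nsets_mono[of "{..<2 * k}" "{..<n}" 2] by (auto simp: simple_graph_def)
    have "A \<union> {2 * k..<n} \<union> B = {..<2 * k} \<union> {2 * k..<n}" using AB(1) by blast
    also have "\<dots> = {..<n}" using kn(1) by auto
    finally have "?A \<union> B = {..<n}" .
    moreover have "{2 * k..<n} \<inter> {..<2 * k} = {}" by auto
    then have "{2 * k..<n} \<inter> B = {}" using AB(1) by blast
    ultimately have bZ: "bipartition ?Z ?A B"
      using Z(2) AB(2) by (fastforce simp: bipartition_def)
    have fZ: "free_of ?Z (complete_bipartite s s)"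
    proof
      assume "contains_copy ?Z (complete_bipartite s s)"
      then obtain \<phi> where \<phi>: "inj_on \<phi> {..<s + s}"
          and "\<forall>e\<in>{{i, s + j} | i j. i < s \<and> j < s}. \<phi> ` e \<in> edges Z"
        unfolding contains_copy_def complete_bipartite_def fst_conv snd_conv by blast
      then have E: "\<phi> ` {i, s + j} \<in> edges Z" if "i < s" "j < s" for i j
        using that by blast
      \<comment> \<open>As \<open>s\<close> is positive, every vertex of the complete bipartite
        graph lies on an edge. A copy therefore avoids the isolated spare vertex and already lives
        in \<open>Z\<close>.\<close>
      have "\<phi> i \<in> {..<2 * k} \<and> \<phi> (s + j) \<in> {..<2 * k}" if "i < s" "j < s" for i j
        using E[OF that] AB(3) by (auto simp: nsets_def)
      then have "\<phi> i \<in> {..<2 * k}" if "i < s + s" for i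
        using that assms(1) by (cases "i < s") (fastforce, metis add_diff_inverse_nat add_less_cancel_left)
      moreover have "verts Z = {..<2 * k}" using Z(1) by (simp add: graphs_on_def)
      ultimately have "contains_copy Z (complete_bipartite s s)"
        using \<phi> E unfolding contains_copy_def complete_bipartite_def
        by (intro exI[of _ \<phi>]) auto
      with Z(5) show False by blast
    qed
    have "card ?A \<le> m"
      using card_Un_le[of A "{2 * k..<n}"] Z(3) kn(2) by simp
    then obtain H where H: "simple_graph H" "verts H = {..<n}" "edges Z \<subseteq> edges H"
      "free_of H (complete_graph (2 * s))" "alpha s H \<le> 2 * alpha s G"
      using bipartite_blowup[OF G(1,2) sZ bZ fZ] Z(4) kn(3) \<open>s > 0\<close> unfolding fst_conv snd_conv by metis
    \<comment> \<open>With \<open>m > 0\<close> the value \<open>alpha s G\<close> is positive, and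
      \<open>c > 2\<close> then gives the strict inequality required by \<open>RT\<close>.\<close>
    have "m > 0" using False m by auto
    then have "alpha s G > 0"
      using G(1) assms(1) by (intro alpha_pos) (auto simp: graphs_on_def)
    have "real (alpha s H) \<le> 2 * real (alpha s G)" using H(5) by linarith
    also have "\<dots> < c * real (alpha s G)" using \<open>alpha s G > 0\<close> assms(2) by simp
    finally have "card (edges H) \<le> RT s n (complete_graph (2 * s)) (c * real (alpha s G))"
      using H by (intro card_edges_le_RT) (auto simp: graphs_on_def)
    moreover have "finite (edges H)"
      using H(1) finite_imp_finite_nsets finite_subset unfolding simple_graph_def by blast
    then have "card (edges Z) \<le> card (edges H)" using H(3) by (rule card_mono)
    ultimately show ?thesis using Z(6) G(3) by (simp add: k_def m_def)
  qed
qed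

end
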